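(* Let $\Delta\ge3$ and $q\ge2$ be integers, let $0<\alpha<\frac{2\pi}{3\Delta}$ and put $\delta_\Delta:=\sin(\alpha/2)\cos(\alpha\Delta/2)$. Fix $\eta\in(0,1)$. Then for any real symmetric $q\times q$ matrix $A$ satisfying $|A_{i,j}-1|<(1-\eta)\delta_\Delta$ for all $i,j=1,\dots,q$, the measure $\mu_{G,A}$ satisfies strong spatial mixing on the family $\mathcal{G}_\Delta$ of all graphs of maximum degree at most $\Delta$, with exponential rate $r=1/(1-\eta)$.
   Context: Graphs are finite and simple; $[q]=\{1,\dots,q\}$. For a graph $G=(V,E)$ and a symmetric $q\times q$ matrix $A$, $Z_G(A)=\sum_{\psi:V\to[q]}\prod_{uv\in E}A_{\psi(u),\psi(v)}$. For nonnegative $A$ with $Z_G(A)\ne0$, the graph homomorphism measure $\mu_{G,A}$ is the probability measure on maps $\psi:V\to[q]$ given by $\mu_{G,A}(\psi)=\prod_{uv\in E}A_{\psi(u),\psi(v)}/Z_G(A)$. For $\Lambda\subset V$, a boundary condition on $\Lambda$ is any map $\sigma:\Lambda\to[q]$. For $v\in V\setminus\Lambda$ and $i\in[q]$, $\Pr_\mu[\psi(v)=i\mid\sigma]$ is the probability that $\psi(v)=i$ for $\psi$ drawn from $\mu=\mu_{G,A}$ conditioned on $\psi|_\Lambda=\sigma$ (this event being assumed to have positive measure). For two boundary conditions $\sigma,\tau$ on $\Lambda$, $d_G(v,\sigma\neq\tau)$ is the graph distance from $v$ to the nearest vertex of $\Lambda$ at which $\sigma$ and $\tau$ differ. The measure $\mu=\mu_{G,A}$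 satisfies strong spatial mixing on a family $\mathcal{G}$ of graphs with exponential rate $r>1$ if there exists a constant $C>0$ such that for every $G=(V,E)\in\mathcal{G}$, every $v\in V$, every $i\in[q]$, every $\Lambda\subseteq V\setminus\{v\}$ and any two boundary conditions $\sigma,\tau$ on $\Lambda$, $\left|\Pr_\mu[\psi(v)=i\mid\sigma]-\Pr_\mu[\psi(v)=i\mid\tau]\right|\le C r^{-d_G(v,\sigma\neq\tau)}$. *)

theory Defs
  imports "HOL-Probability.Probability"
begin

record 'v ugraph =
  verts :: "'v set"
  edges :: "'v set set"

definition simple_graph :: "'v ugraph \<Rightarrow> bool" where
  "simple_graph G \<longleftrightarrow> finite (verts G) \<and> (\<forall>e\<in>edges G. e \<subseteq> verts G \<and> card e = 2)"

definition degree :: "'v ugraph \<Rightarrow> 'v \<Rightarrow> nat" where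
  "degree G v = card {e \<in> edges G. v \<in> e}"

definition bounded_degree_graphs :: "nat \<Rightarrow> 'v ugraph set" where
  "bounded_degree_graphs \<Delta> = {G. simple_graph G \<and> (\<forall>v\<in>verts G. degree G v \<le> \<Delta>)}"

definition adj :: "'v ugraph \<Rightarrow> 'v rel" where
  "adj G = {(u, v). {u, v} \<in> edges G}"

text \<open>A pair is in the \<open>n\<close>-th relational power of the adjacency relation iff it is joined by a
  walk of length \<open>n\<close>. The infimum of the empty set in \<^typ>\<open>enat\<close> is \<open>\<infinity>\<close>, so vertices in different
  components have infinite distance.\<close>

definition graph_dist :: "'v ugraph \<Rightarrow> 'v \<Rightarrow> 'v \<Rightarrow> enat" where
  "graph_dist G u v = (INF n\<in>{n. (u, v) \<in> adj G ^^ n}. enat n)"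

text \<open>This is \<open>\<infinity>\<close> if \<open>\<sigma>\<close> and \<open>\<tau>\<close> agree on \<open>\<Lambda>\<close>.\<close>

definition disagreement_dist ::
    "'v ugraph \<Rightarrow> 'v \<Rightarrow> 'v set \<Rightarrow> ('v \<Rightarrow> 'q) \<Rightarrow> ('v \<Rightarrow> 'q) \<Rightarrow> enat" where
  "disagreement_dist G v \<Lambda> \<sigma> \<tau> = (INF u\<in>{u\<in>\<Lambda>. \<sigma> u \<noteq> \<tau> u}. graph_dist G v u)"

text \<open>The spins \<open>[q]\<close> are the elements of a finite type \<open>'q\<close> with \<open>q = CARD('q)\<close>. Maps on a vertex
  set \<open>W\<close> are the elements of \<open>W \<rightarrow>\<^sub>E UNIV\<close>, i.e. they take the value \<^const>\<open>undefined\<close>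
  outside \<open>W\<close>.\<close>

text \<open>The factor of an edge \<open>{u, v}\<close> is \<open>A $ \<psi> u $ \<psi> v\<close>; it does not depend on the order of the
  endpoints when \<open>A\<close> is symmetric.\<close>

definition edge_weight :: "real^'q^'q \<Rightarrow> ('v \<Rightarrow> 'q) \<Rightarrow> 'v set \<Rightarrow> real" where
  "edge_weight A \<psi> e = (THE a. \<exists>u v. e = {u, v} \<and> a = A $ \<psi> u $ \<psi> v)"

lemma edge_weight_doubleton:
  assumes "transpose A = A"
  shows "edge_weight A \<psi> {u, v} = A $ \<psi> u $ \<psi> v"
proof -
  have sym: "A $ i $ j = A $ j $ i" for i j
    by (metis assms transpose_def vec_lambda_beta)
  show ?thesis
    unfolding edge_weight_def
    by (rule the_equality) (auto simp: doubleton_eq_iff sym)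
qed

definition hom_weight :: "'v ugraph \<Rightarrow> real^'q^'q \<Rightarrow> ('v \<Rightarrow> 'q) \<Rightarrow> real" where
  "hom_weight G A \<psi> = (\<Prod>e\<in>edges G. edge_weight A \<psi> e)"

definition partition_function :: "'v ugraph \<Rightarrow> real^'q::finite^'q \<Rightarrow> real" where
  "partition_function G A = (\<Sum>\<psi>\<in>verts G \<rightarrow>\<^sub>E UNIV. hom_weight G A \<psi>)"

definition hom_measure :: "'v ugraph \<Rightarrow> real^'q::finite^'q \<Rightarrow> ('v \<Rightarrow> 'q) measure" where
  "hom_measure G A =
    point_measure (verts G \<rightarrow>\<^sub>E UNIV) (\<lambda>\<psi>. ennreal (hom_weight G A \<psi> / partition_function G A))"

lemma hom_weight_pos:
  assumes "simple_graph G" "transpose A = A" "\<And>i j. A $ i $ j > 0"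
  shows "hom_weight G A \<psi> > 0"
  unfolding hom_weight_def
proof (rule prod_pos)
  fix e assume "e \<in> edges G"
  then obtain u v where "e = {u, v}"
    using assms(1) unfolding simple_graph_def by (meson card_2_iff)
  then show "edge_weight A \<psi> e > 0"
    using assms by (simp add: edge_weight_doubleton)
qed

lemma partition_function_pos:
  assumes "simple_graph G" "transpose A = A" "\<And>i j. A $ i $ j > 0"
  shows "partition_function G A > 0"
  unfolding partition_function_def
  using assms by (intro sum_pos finite_PiE)
    (auto simp: simple_graph_def PiE_eq_empty_iff intro!: hom_weight_pos)

lemma prob_space_hom_measure:
  assumes G: "simple_graph G" and A: "transpose A = A"
    and nonneg: "\<And>i j. A $ i $ j \<ge> 0" and Z: "partition_function G A \<noteq> 0"
  shows "prob_space (hom_measure G A)"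
proof
  have fin: "finite (verts G \<rightarrow>\<^sub>E (UNIV :: 'b set))"
    using G by (auto simp: simple_graph_def intro: finite_PiE)
  have w: "hom_weight G A \<psi> \<ge> 0" for \<psi>
    unfolding hom_weight_def
  proof (rule prod_nonneg)
    fix e assume "e \<in> edges G"
    then obtain u v where "e = {u, v}"
      using G unfolding simple_graph_def by (meson card_2_iff)
    then show "edge_weight A \<psi> e \<ge> 0"
      using A nonneg by (simp add: edge_weight_doubleton)
  qed
  have Z0: "partition_function G A \<ge> 0"
    unfolding partition_function_def by (intro sum_nonneg w)
  have "emeasure (hom_measure G A) (space (hom_measure G A))
      = (\<Sum>\<psi>\<in>verts G \<rightarrow>\<^sub>E UNIV. ennreal (hom_weight G A \<psi> / partition_function G A))"
    unfolding hom_measure_def by (simp add: emeasure_point_measure_finite fin space_point_measure)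
  also have "\<dots> = ennreal (\<Sum>\<psi>\<in>verts G \<rightarrow>\<^sub>E UNIV. hom_weight G A \<psi> / partition_function G A)"
    by (rule sum_ennreal) (simp add: w Z0)
  also have "\<dots> = 1"
    using Z by (simp add: partition_function_def flip: sum_divide_distrib)
  finally show "emeasure (hom_measure G A) (space (hom_measure G A)) = 1" .
qed

text \<open>The quantity \<open>r\<^sup>-\<^sup>d\<close>, with \<open>r\<^sup>-\<^sup>\<infinity> = 0\<close>.\<close>

definition exp_decay :: "real \<Rightarrow> enat \<Rightarrow> real" where
  "exp_decay r d = (case d of enat n \<Rightarrow> r powi (- int n) | \<infinity> \<Rightarrow> 0)"

definition boundary_event :: "'v set \<Rightarrow> ('v \<Rightarrow> 'q) \<Rightarrow> ('v \<Rightarrow> 'q) \<Rightarrow> bool" where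
  "boundary_event \<Lambda> \<sigma> \<psi> \<longleftrightarrow> restrict \<psi> \<Lambda> = \<sigma>"

text \<open>The constant \<open>C\<close> is uniform over the family. Taking the vertex type \<open>'v\<close> to be \<^typ>\<open>nat\<close>
  covers all finite graphs up to isomorphism. Conditioning is only considered for boundary conditions
  of positive measure.\<close>

definition strong_spatial_mixing ::
    "real^'q::finite^'q \<Rightarrow> 'v ugraph set \<Rightarrow> real \<Rightarrow> bool" where
  "strong_spatial_mixing A \<G> r \<longleftrightarrow> r > 1 \<and>
    (\<exists>C>0. \<forall>G\<in>\<G>. \<forall>v\<in>verts G. \<forall>i. \<forall>\<Lambda>\<subseteq>verts G - {v}.
      \<forall>\<sigma>\<in>\<Lambda> \<rightarrow>\<^sub>E UNIV. \<forall>\<tau>\<in>\<Lambda> \<rightarrow>\<^sub>E UNIV.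
        \<P>(\<psi> in hom_measure G A. boundary_event \<Lambda> \<sigma> \<psi>) > 0 \<longrightarrow>
        \<P>(\<psi> in hom_measure G A. boundary_event \<Lambda> \<tau> \<psi>) > 0 \<longrightarrow>
        \<bar>\<P>(\<psi> in hom_measure G A. \<psi> v = i \<bar> boundary_event \<Lambda> \<sigma> \<psi>)
          - \<P>(\<psi> in hom_measure G A. \<psi> v = i \<bar> boundary_event \<Lambda> \<tau> \<psi>)\<bar>
        \<le> C * exp_decay r (disagreement_dist G v \<Lambda> \<sigma> \<tau>))"

lemma boundary_event_pos:
  fixes A :: "real^'q::finite^'q"
  assumes G: "simple_graph G" and A: "transpose A = A" and pos: "\<And>i j. A $ i $ j > 0"
    and L: "\<Lambda> \<subseteq> verts G" and s: "\<sigma> \<in> \<Lambda> \<rightarrow>\<^sub>E UNIV"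
  shows "\<P>(\<psi> in hom_measure G A. boundary_event \<Lambda> \<sigma> \<psi>) > 0"
proof -
  let ?S = "verts G \<rightarrow>\<^sub>E (UNIV :: 'q set)" and ?M = "hom_measure G A"
  let ?\<psi> = "restrict \<sigma> (verts G)"
  interpret prob_space ?M
    using G A pos partition_function_pos[OF G A pos]
    by (intro prob_space_hom_measure) (auto intro: less_imp_le)
  have fin: "finite ?S" using G by (auto simp: simple_graph_def intro: finite_PiE)
  have sets: "sets ?M = Pow ?S" and space: "space ?M = ?S"
    by (auto simp: hom_measure_def sets_point_measure space_point_measure)
  have mem: "?\<psi> \<in> {\<psi> \<in> space ?M. boundary_event \<Lambda> \<sigma> \<psi>}"
    using L s by (auto simp: space boundary_event_def Int_absorb1 PiE_restrict)
  have "0 < hom_weight G A ?\<psi> / partition_function G A"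
    by (intro divide_pos_pos hom_weight_pos partition_function_pos G A pos)
  also have "\<dots> = measure ?M {?\<psi>}"
    using fin calculation
    by (simp add: hom_measure_def measure_def emeasure_point_measure_finite)
  also have "\<dots> \<le> \<P>(\<psi> in ?M. boundary_event \<Lambda> \<sigma> \<psi>)"
    by (rule finite_measure_mono) (use mem sets space in auto)
  finally show ?thesis .
qed

end

theory Submission
  imports Defs "HOL-Complex_Analysis.Conformal_Mappings"
begin

text \<open>Put \<open>A\<^sub>z = 1 + z (A - 1)\<close> and regard the conditional probability of \<open>\<psi> v = i\<close> as a quotient of
  partition functions with pinned vertices, hence as a rational function of \<open>z\<close>. For \<open>\<bar>z\<bar> \<le> r\<close> the
  matrix \<open>A\<^sub>z\<close> satisfies Barvinok's condition, so no pinned partition function vanishes. Moreover, those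
  that differ in the spin at one vertex enclose an angle below \<open>2\<pi>/3\<close>, which bounds every conditional
  probability by 2 on the disk. Expanding in powers of \<open>z\<close>, a term of the difference of the two
  conditional probabilities survives only if its edges connect \<open>v\<close> to a disagreement; hence the
  difference vanishes at 0 to order at least the disagreement distance \<open>d\<close>, and the maximum principle for
  its quotient by \<open>z\<^sup>d\<close> gives the bound \<open>4 r\<^sup>-\<^sup>d\<close> at \<open>z = 1\<close>.\<close>

subsection \<open>Vectors in a sector\<close>

text \<open>The angle is encoded by a polar factor and not by a difference of \<open>Arg\<close>
  values, so that angles add under composition without branch cuts.\<close>

definition within_angle :: "real \<Rightarrow> complex \<Rightarrow> complex \<Rightarrow> bool" where
  "within_angle \<beta> z w \<longleftrightarrow> z \<noteq> 0 \<and> (\<exists>r t. 0 < r \<and> \<bar>t\<bar> \<le> \<beta> \<and> w = of_real r * cis t * z)"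

lemma within_angle_nonzero: "within_angle \<beta> z w \<Longrightarrow> z \<noteq> 0 \<and> w \<noteq> 0"
  by (auto simp: within_angle_def)

lemma within_angle_refl: "0 \<le> \<beta> \<Longrightarrow> z \<noteq> 0 \<Longrightarrow> within_angle \<beta> z z"
  unfolding within_angle_def by (intro conjI exI[of _ 1] exI[of _ 0]) auto

lemma within_angle_mono: "within_angle \<beta> z w \<Longrightarrow> \<beta> \<le> \<gamma> \<Longrightarrow> within_angle \<gamma> z w"
  unfolding within_angle_def by force

lemma within_angle_sym:
  assumes "within_angle \<beta> z w"
  shows "within_angle \<beta> w z"
proof -
  obtain r t where rt: "0 < r" "\<bar>t\<bar> \<le> \<beta>" "w = of_real r * cis t * z"
    using assms by (auto simp: within_angle_def)
  have "z = of_real (1 / r) * cis (- t) * w"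
    using rt(1) by (simp add: rt(3) cis_mult)
  then show ?thesis
    unfolding within_angle_def using rt within_angle_nonzero[OF assms]
    by (intro conjI exI[of _ "1 / r"] exI[of _ "- t"]) auto
qed

lemma within_angle_trans:
  assumes "within_angle \<beta> x y" "within_angle \<gamma> y z"
  shows "within_angle (\<beta> + \<gamma>) x z"
proof -
  obtain r t where rt: "0 < r" "\<bar>t\<bar> \<le> \<beta>" "y = of_real r * cis t * x"
    using assms by (auto simp: within_angle_def)
  obtain s u where su: "0 < s" "\<bar>u\<bar> \<le> \<gamma>" "z = of_real s * cis u * y"
    using assms by (auto simp: within_angle_def)
  have "z = of_real (s * r) * cis (u + t) * x"
    by (simp add: su(3) rt(3) flip: cis_mult)
  then show ?thesis
    unfolding within_angle_def using rt su within_angle_nonzero[OF assms(1)]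
    by (intro conjI exI[of _ "s * r"] exI[of _ "u + t"]) auto
qed

text \<open>The quotient \<open>w / z\<close> lies in the closed disk of radius \<open>sin t\<close>
  about 1, and the tangents from 0 to that disk make the angle \<open>t\<close> with the real
  axis.\<close>

lemma within_angle_perturb:
  assumes z: "z \<noteq> 0" and t: "0 \<le> t" "t < pi / 2"
    and le: "cmod (w - z) \<le> sin t * cmod z"
  shows "within_angle t z w"
proof -
  define x where "x = w / z"
  have "cmod (x - 1) = cmod (w - z) / cmod z"
    using z by (simp add: x_def diff_divide_distrib flip: norm_divide)
  also have "\<dots> \<le> sin t" using le z by (simp add: divide_le_eq)
  finally have x: "cmod (x - 1) \<le> sin t" .
  have "sin t < 1"
    using t sin_monotone_2pi[of t "pi / 2"] by simp
  with x have Re: "Re x > 0"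
    using abs_Re_le_cmod[of "x - 1"] by (auto simp: abs_le_iff)
  then have x0: "x \<noteq> 0" by auto
  have Arg: "\<bar>Arg x\<bar> < pi / 2"
    using Re Arg_Re_pos by blast
  have x_eq: "x = of_real (cmod x) * cis (Arg x)"
    using cis_Arg[OF x0] x0 by (simp add: sgn_eq)
  \<comment> \<open>After rotating \<open>x\<close> onto the positive real axis, the imaginary part
    measures the distance from 1 to the line through 0 and \<open>x\<close>, which is at most
    \<open>cmod (x - 1)\<close>.\<close>
  have "Im ((x - 1) * cis (- Arg x)) = sin (Arg x)"
    by (subst x_eq, simp add: left_diff_distrib mult.assoc cis_mult)
  then have "\<bar>sin (Arg x)\<bar> \<le> cmod ((x - 1) * cis (- Arg x))"
    by (metis abs_Im_le_cmod)
  then have "\<bar>sin (Arg x)\<bar> \<le> sin t"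
    using x by (simp add: norm_mult)
  then have "sin \<bar>Arg x\<bar> \<le> sin t" by (simp add: abs_if split: if_splits)
  then have "\<bar>Arg x\<bar> \<le> t"
    using Arg t sin_mono_le_eq[of "\<bar>Arg x\<bar>" t] by auto
  moreover have "w = of_real (cmod x) * cis (Arg x) * z"
    using x_eq z by (simp add: x_def)
  ultimately show ?thesis
    unfolding within_angle_def using z x0 by (intro conjI exI[of _ "cmod x"] exI[of _ "Arg x"]) auto
qed

text \<open>Arguments measured from a fixed reference vector lie within \<open>2\<beta>\<close> of each other, and since
  \<open>3\<beta> < 2\<pi>\<close> the pairwise bound \<open>\<beta>\<close> cannot hold only modulo \<open>2\<pi>\<close>; so all vectors lie in a common
  sector of angle \<open>\<beta>\<close>, and the sum is estimated by projecting onto its bisector.\<close>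

lemma norm_sum_ge_within_angle:
  fixes X :: "'q::finite \<Rightarrow> complex"
  assumes X: "\<And>k l. within_angle \<beta> (X k) (X l)" and \<beta>: "0 \<le> \<beta>" "\<beta> < 2 * pi / 3"
  shows "cos (\<beta> / 2) * (\<Sum>k\<in>UNIV. cmod (X k)) \<le> cmod (\<Sum>k\<in>UNIV. X k)"
proof -
  define k0 :: 'q where "k0 = undefined"
  have "\<forall>k. \<exists>r t. 0 < r \<and> \<bar>t\<bar> \<le> \<beta> \<and> X k = of_real r * cis t * X k0"
    using X by (auto simp: within_angle_def)
  then obtain r t where r: "\<And>k. 0 < r k" and t: "\<And>k. \<bar>t k\<bar> \<le> \<beta>"
    and eq: "\<And>k. X k = of_real (r k) * cis (t k) * X k0"
    by metis
  have X0: "X k0 \<noteq> 0" using X within_angle_nonzero by blast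
  have close: "\<bar>t l - t k\<bar> \<le> \<beta>" for k l
  proof -
    obtain \<rho> s where \<rho>: "0 < \<rho>" "\<bar>s\<bar> \<le> \<beta>" "X l = of_real \<rho> * cis s * X k"
      using X[of k l] by (auto simp: within_angle_def)
    have e: "rcis (r l) (t l) = rcis (\<rho> * r k) (s + t k)"
      using \<rho>(3) X0 unfolding eq[of l] eq[of k] by (simp add: rcis_def flip: cis_mult)
    have "cmod (rcis (r l) (t l)) = cmod (rcis (\<rho> * r k) (s + t k))"
      by (simp only: e)
    then have "r l = \<rho> * r k" using r[of k] r[of l] \<rho>(1) by simp
    then have "cis (t l) = cis (s + t k)"
      using e r[of l] by (auto simp: rcis_def)
    then have "sin (t l) = sin (s + t k) \<and> cos (t l) = cos (s + t k)"
      by (simp add: complex_eq_iff)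
    then obtain n :: int where n: "t l = s + t k + 2 * pi * of_int n"
      unfolding sin_cos_eq_iff by auto
    have "\<bar>2 * pi * of_int n\<bar> < 2 * pi"
      using n \<rho>(2) t[of l] t[of k] \<beta> by linarith
    then have "\<bar>of_int n :: real\<bar> < 1" by (simp add: abs_mult)
    then have "n = 0" by linarith
    with n \<rho>(2) show ?thesis by simp
  qed
  \<comment> \<open>The midpoint of the smallest interval containing all angles: the direction of
    the bisector relative to \<open>X k0\<close>.\<close>
  define c where "c = (Max (range t) + Min (range t)) / 2"
  have "Max (range t) \<in> range t" by (rule Max_in) auto
  then obtain kM where kM: "Max (range t) = t kM" by (rule imageE)
  have "Min (range t) \<in> range t" by (rule Min_in) auto
  then obtain km where km: "Min (range t) = t km" by (rule imageE)
  have c: "\<bar>t k - c\<bar> \<le> \<beta> / 2" for k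
  proof -
    have "t k \<le> t kM" "t km \<le> t k"
      using Max_ge[of "range t" "t k"] Min_le[of "range t" "t k"] kM km by auto
    moreover have "t kM - t km \<le> \<beta>" using close[of kM km] by linarith
    ultimately show ?thesis unfolding c_def kM km by (simp add: field_simps abs_le_iff)
  qed
  have "cos (\<beta> / 2) \<le> cos (t k - c)" for k
    using c[of k] \<beta> cos_monotone_0_pi_le[of "\<bar>t k - c\<bar>" "\<beta> / 2"] by simp
  then have "(\<Sum>k\<in>UNIV. cos (\<beta> / 2) * r k) \<le> (\<Sum>k\<in>UNIV. r k * cos (t k - c))"
    using r by (intro sum_mono) (simp add: mult.commute less_imp_le)
  also have "\<dots> = Re (\<Sum>k\<in>UNIV. of_real (r k) * cis (t k - c))" by simp
  also have "\<dots> \<le> cmod (\<Sum>k\<in>UNIV. of_real (r k) * cis (t k - c))"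
    by (rule complex_Re_le_cmod)
  finally have "(\<Sum>k\<in>UNIV. cos (\<beta> / 2) * r k) * cmod (X k0)
      \<le> cmod (\<Sum>k\<in>UNIV. of_real (r k) * cis (t k - c)) * cmod (X k0)"
    by (rule mult_right_mono) simp
  also have "\<dots> = cmod (\<Sum>k\<in>UNIV. X k)"
  proof -
    have "(\<Sum>k\<in>UNIV. X k) = cis c * (\<Sum>k\<in>UNIV. of_real (r k) * cis (t k - c)) * X k0"
      unfolding sum_distrib_left sum_distrib_right
      by (intro sum.cong refl, subst eq) (simp add: cis_mult algebra_simps)
    then show ?thesis by (simp add: norm_mult)
  qed
  also have "(\<Sum>k\<in>UNIV. cos (\<beta> / 2) * r k) * cmod (X k0) = cos (\<beta> / 2) * (\<Sum>k\<in>UNIV. cmod (X k))"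
    unfolding sum_distrib_left sum_distrib_right
    by (intro sum.cong refl, subst (2) eq) (use r in \<open>simp add: norm_mult less_imp_le\<close>)
  finally show ?thesis .
qed

subsection \<open>Pinned partition functions without zeros\<close>

text \<open>Complex counterpart of \<open>edge_weight\<close>, with a function in place of the
  matrix so that the weights may depend on a complex parameter.\<close>

definition edge_val :: "('q \<Rightarrow> 'q \<Rightarrow> complex) \<Rightarrow> ('v \<Rightarrow> 'q) \<Rightarrow> 'v set \<Rightarrow> complex" where
  "edge_val a \<psi> e = (THE c. \<exists>u v. e = {u, v} \<and> c = a (\<psi> u) (\<psi> v))"

text \<open>Only the values of \<open>\<sigma>\<close> on \<open>\<Lambda>\<close> count; since
  \<open>\<sigma>\<close> is total, pinning one more vertex is a plain function update.\<close>

definition pinned_maps :: "'v set \<Rightarrow> 'v set \<Rightarrow> ('v \<Rightarrow> 'q) \<Rightarrow> ('v \<Rightarrow> 'q) set" where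
  "pinned_maps V \<Lambda> \<sigma> = {\<psi> \<in> V \<rightarrow>\<^sub>E UNIV. \<forall>u\<in>\<Lambda>. \<psi> u = \<sigma> u}"

text \<open>Vertices and edges are separate arguments because the induction removes edges while
  keeping \<open>V\<close>.\<close>

definition pinned_sum ::
    "'v set \<Rightarrow> 'v set set \<Rightarrow> ('q \<Rightarrow> 'q \<Rightarrow> complex) \<Rightarrow> 'v set \<Rightarrow> ('v \<Rightarrow> 'q) \<Rightarrow> complex" where
  "pinned_sum V E a \<Lambda> \<sigma> = (\<Sum>\<psi>\<in>pinned_maps V \<Lambda> \<sigma>. \<Prod>e\<in>E. edge_val a \<psi> e)"

lemma edge_val_doubleton:
  assumes "\<And>i j. a i j = a j i"
  shows "edge_val a \<psi> {u, v} = a (\<psi> u) (\<psi> v)"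
  unfolding edge_val_def by (rule the_equality) (auto simp: doubleton_eq_iff assms)

lemma edge_val_cong:
  assumes "\<And>x. x \<in> e \<Longrightarrow> \<psi> x = \<phi> x"
  shows "edge_val a \<psi> e = edge_val a \<phi> e"
proof -
  have "(\<exists>u v. e = {u, v} \<and> c = a (\<psi> u) (\<psi> v)) \<longleftrightarrow> (\<exists>u v. e = {u, v} \<and> c = a (\<phi> u) (\<phi> v))" for c
    using assms by (metis insertCI)
  then show ?thesis by (simp add: edge_val_def)
qed

lemma finite_pinned_maps: "finite V \<Longrightarrow> finite (pinned_maps V \<Lambda> (\<sigma> :: 'v \<Rightarrow> 'q::finite))"
  unfolding pinned_maps_def by (rule finite_subset[of _ "V \<rightarrow>\<^sub>E UNIV"]) (auto intro: finite_PiE)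

lemma pinned_maps_nonempty:
  assumes "\<Lambda> \<subseteq> V"
  shows "pinned_maps V \<Lambda> \<sigma> \<noteq> {}"
proof -
  have "restrict \<sigma> V \<in> pinned_maps V \<Lambda> \<sigma>"
    using assms by (auto simp: pinned_maps_def)
  then show ?thesis by auto
qed

lemma pinned_sum_split:
  fixes \<sigma> :: "'v \<Rightarrow> 'q::finite"
  assumes V: "finite V" and u: "u \<notin> \<Lambda>"
  shows "pinned_sum V E a \<Lambda> \<sigma> = (\<Sum>k\<in>UNIV. pinned_sum V E a (insert u \<Lambda>) (\<sigma>(u := k)))"
proof -
  have "pinned_maps V (insert u \<Lambda>) (\<sigma>(u := k)) = {\<psi> \<in> pinned_maps V \<Lambda> \<sigma>. \<psi> u = k}" for k
    using u by (fastforce simp: pinned_maps_def)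
  then show ?thesis
    unfolding pinned_sum_def
    using sum.group[of "pinned_maps V \<Lambda> \<sigma>" UNIV "\<lambda>\<psi>. \<psi> u" "\<lambda>\<psi>. \<Prod>e\<in>E. edge_val a \<psi> e"]
    by (simp add: finite_pinned_maps V)
qed

lemma pinned_sum_insert_pinned_edge:
  assumes a: "\<And>i j. a i j = a j i" and E: "finite E" "{u, w} \<notin> E" and uw: "u \<in> \<Lambda>" "w \<in> \<Lambda>"
  shows "pinned_sum V (insert {u, w} E) a \<Lambda> \<sigma> = a (\<sigma> u) (\<sigma> w) * pinned_sum V E a \<Lambda> \<sigma>"
  unfolding pinned_sum_def sum_distrib_left
  using E uw by (intro sum.cong refl) (auto simp: edge_val_doubleton[of a, OF a] pinned_maps_def)

text \<open>Overwriting the spin at \<open>u\<close> is a bijection between the two sets of maps,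
  and no edge sees the change.\<close>

lemma pinned_sum_isolated:
  assumes u: "u \<in> V" and E: "\<And>e. e \<in> E \<Longrightarrow> u \<notin> e"
  shows "pinned_sum V E a (insert u \<Lambda>) (\<sigma>(u := k)) = pinned_sum V E a (insert u \<Lambda>) (\<sigma>(u := l))"
  unfolding pinned_sum_def
proof (rule sum.reindex_bij_witness[where i = "\<lambda>\<psi>. \<psi>(u := k)" and j = "\<lambda>\<psi>. \<psi>(u := l)"])
  fix \<psi> assume "\<psi> \<in> pinned_maps V (insert u \<Lambda>) (\<sigma>(u := k))"
  show "(\<Prod>e\<in>E. edge_val a (\<psi>(u := l)) e) = (\<Prod>e\<in>E. edge_val a \<psi> e)"
    using E by (intro prod.cong refl edge_val_cong) auto
qed (use u in \<open>auto simp: pinned_maps_def PiE_def extensional_def fun_eq_iff\<close>)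

text \<open>The induction on the edge set needs both properties: nonvanishing for \<open>E\<close> uses the angle bound
  for \<open>E\<close>, which uses nonvanishing for proper subsets of \<open>E\<close>.\<close>

definition sector_property ::
    "real \<Rightarrow> ('q \<Rightarrow> 'q \<Rightarrow> complex) \<Rightarrow> 'v set \<Rightarrow> 'v set set \<Rightarrow> bool" where
  "sector_property \<beta> a V E \<longleftrightarrow> (\<forall>\<Lambda>\<subseteq>V. \<forall>\<sigma>. pinned_sum V E a \<Lambda> \<sigma> \<noteq> 0 \<and>
     (\<forall>u\<in>V - \<Lambda>. \<forall>k l. within_angle \<beta> (pinned_sum V E a (insert u \<Lambda>) (\<sigma>(u := k)))
                                   (pinned_sum V E a (insert u \<Lambda>) (\<sigma>(u := l)))))"

text \<open>In \<open>near_one\<close> the sine is the relative change that keeps the rotation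
  caused by one edge within \<open>\<alpha> / 2\<close>; the cosine compensates the cancellation in
  a sum of vectors from a sector of angle \<open>\<Delta> * \<alpha>\<close>.\<close>

locale barvinok_weights =
  fixes a :: "'q::finite \<Rightarrow> 'q \<Rightarrow> complex" and \<alpha> :: real and \<Delta> :: nat
  assumes sym: "a i j = a j i"
    and \<alpha>: "0 < \<alpha>" "real \<Delta> * \<alpha> < 2 * pi / 3" and \<Delta>: "\<Delta> \<ge> 3"
    and near_one: "cmod (a i j - 1) \<le> sin (\<alpha> / 2) * cos (\<alpha> * real \<Delta> / 2)"
begin

lemma \<alpha>_less: "\<alpha> / 2 < pi / 2"
proof -
  have "3 * \<alpha> \<le> real \<Delta> * \<alpha>" using \<Delta> \<alpha>(1) by (intro mult_right_mono) auto
  then show ?thesis using \<alpha> pi_gt_zero by linarith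
qed

lemma sin_pos: "0 < sin (\<alpha> / 2)"
  using \<alpha>_less \<alpha> pi_gt_zero by (intro sin_gt_zero) auto

lemma cos_gt_half: "1 / 2 < cos (\<alpha> * real \<Delta> / 2)"
proof -
  have "cos (pi / 3) < cos (\<alpha> * real \<Delta> / 2)"
    using \<alpha> pi_gt_zero by (intro cos_monotone_0_pi) (auto simp: mult.commute)
  then show ?thesis by (simp add: cos_60)
qed

lemma near_one_sin: "cmod (a i j - 1) \<le> sin (\<alpha> / 2)"
proof -
  have "sin (\<alpha> / 2) * cos (\<alpha> * real \<Delta> / 2) \<le> sin (\<alpha> / 2) * 1"
    using sin_pos by (intro mult_left_mono) auto
  with near_one[of i j] show ?thesis by simp
qed

lemma norm_sum_ge:
  assumes "\<And>k l. within_angle (real \<Delta> * \<alpha>) (X k) (X l)"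
  shows "cos (\<alpha> * real \<Delta> / 2) * (\<Sum>k\<in>UNIV. cmod (X k)) \<le> cmod (\<Sum>k\<in>(UNIV :: 'q set). X k)"
  using norm_sum_ge_within_angle[of "real \<Delta> * \<alpha>" X] assms \<alpha> by (simp add: mult.commute)

lemma sum_nonzero:
  assumes "\<And>k l. within_angle (real \<Delta> * \<alpha>) (X k) (X l)"
  shows "(\<Sum>k\<in>(UNIV :: 'q set). X k) \<noteq> 0"
proof -
  have "X k \<noteq> 0" for k using assms within_angle_nonzero by blast
  then have "0 < (\<Sum>k\<in>UNIV. cmod (X k))" by (intro sum_pos) auto
  then have "0 < cos (\<alpha> * real \<Delta> / 2) * (\<Sum>k\<in>UNIV. cmod (X k))"
    using cos_gt_half by (intro mult_pos_pos) auto
  also have "\<dots> \<le> cmod (\<Sum>k\<in>UNIV. X k)" by (rule norm_sum_ge) (rule assms)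
  finally show ?thesis by auto
qed

text \<open>The new edge changes the sum by a relative amount of at most
  \<open>sin (\<alpha> / 2)\<close>. This is immediate if both endpoints are pinned; otherwise the
  sum is first split over the spins at \<open>w\<close>.\<close>

lemma within_angle_insert_edge:
  assumes V: "finite V" and \<Lambda>: "\<Lambda> \<subseteq> V" and E: "finite E" "{u, w} \<notin> E"
    and u: "u \<in> \<Lambda>" and w: "w \<in> V"
    and sec: "sector_property (real \<Delta> * \<alpha>) a V E"
  shows "within_angle (\<alpha> / 2) (pinned_sum V E a \<Lambda> \<sigma>) (pinned_sum V (insert {u, w} E) a \<Lambda> \<sigma>)"
proof (rule within_angle_perturb)
  show "pinned_sum V E a \<Lambda> \<sigma> \<noteq> 0" using sec \<Lambda> by (simp add: sector_property_def)
  show "0 \<le> \<alpha> / 2" "\<alpha> / 2 < pi / 2" using \<alpha> \<alpha>_less by auto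
  show "cmod (pinned_sum V (insert {u, w} E) a \<Lambda> \<sigma> - pinned_sum V E a \<Lambda> \<sigma>)
      \<le> sin (\<alpha> / 2) * cmod (pinned_sum V E a \<Lambda> \<sigma>)"
  proof (cases "w \<in> \<Lambda>")
    case True
    have "pinned_sum V (insert {u, w} E) a \<Lambda> \<sigma> - pinned_sum V E a \<Lambda> \<sigma>
        = (a (\<sigma> u) (\<sigma> w) - 1) * pinned_sum V E a \<Lambda> \<sigma>"
      using pinned_sum_insert_pinned_edge[of a E u w \<Lambda> V \<sigma>, OF sym E u True]
      by (simp add: left_diff_distrib)
    then show ?thesis by (simp add: norm_mult mult_right_mono near_one_sin)
  next
    case False
    define X where "X k = pinned_sum V E a (insert w \<Lambda>) (\<sigma>(w := k))" for k
    have uw: "u \<noteq> w" using False u by auto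
    have X: "pinned_sum V E a \<Lambda> \<sigma> = (\<Sum>k\<in>UNIV. X k)"
      unfolding X_def by (rule pinned_sum_split[OF V False])
    have "pinned_sum V (insert {u, w} E) a \<Lambda> \<sigma> = (\<Sum>k\<in>UNIV. a (\<sigma> u) k * X k)"
      unfolding X_def pinned_sum_split[OF V False]
      using uw u by (intro sum.cong refl)
        (subst pinned_sum_insert_pinned_edge[of a, OF sym E], auto)
    then have "pinned_sum V (insert {u, w} E) a \<Lambda> \<sigma> - pinned_sum V E a \<Lambda> \<sigma>
        = (\<Sum>k\<in>UNIV. (a (\<sigma> u) k - 1) * X k)"
      by (simp add: X left_diff_distrib sum_subtractf)
    also have "cmod \<dots> \<le> (\<Sum>k\<in>UNIV. sin (\<alpha> / 2) * cos (\<alpha> * real \<Delta> / 2) * cmod (X k))"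
      by (rule sum_norm_le) (simp add: norm_mult mult_right_mono near_one)
    also have "\<dots> = sin (\<alpha> / 2) * (cos (\<alpha> * real \<Delta> / 2) * (\<Sum>k\<in>UNIV. cmod (X k)))"
      by (simp add: sum_distrib_left mult.assoc)
    also have "\<dots> \<le> sin (\<alpha> / 2) * cmod (\<Sum>k\<in>UNIV. X k)"
    \<comment> \<open>Here the cosine is spent: the angle bound for \<open>E\<close> puts the
      \<open>X k\<close> into a common sector, so their sum retains that fraction of the total
      length.\<close>
    proof (intro mult_left_mono norm_sum_ge)
      show "within_angle (real \<Delta> * \<alpha>) (X k) (X l)" for k l
        using sec \<Lambda> w False unfolding sector_property_def X_def by blast
    qed (use sin_pos in auto)
    finally show ?thesis by (simp add: X)
  qed
qed

text \<open>The edges at \<open>u\<close> are added one by one, each costing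
  \<open>\<alpha> / 2\<close>. The sector property is needed only before each addition, hence only
  for proper subsets of \<open>S\<close>; so the induction can apply this with
  \<open>S \<union> E\<close> as its full edge set.\<close>

lemma within_angle_add_star:
  assumes V: "finite V" and \<Lambda>: "\<Lambda> \<subseteq> V" and u: "u \<in> \<Lambda>" and E: "finite E" and S: "finite S"
    and S_edge: "\<And>e. e \<in> S \<Longrightarrow> u \<in> e \<and> e \<subseteq> V \<and> card e = 2" and disj: "S \<inter> E = {}"
    and sec: "\<And>T. T \<subset> S \<Longrightarrow> sector_property (real \<Delta> * \<alpha>) a V (T \<union> E)"
    and ne: "pinned_sum V E a \<Lambda> \<sigma> \<noteq> 0"
  shows "within_angle (real (card S) * (\<alpha> / 2)) (pinned_sum V E a \<Lambda> \<sigma>) (pinned_sum V (S \<union> E) a \<Lambda> \<sigma>)"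
  using S S_edge disj sec
proof (induction S rule: finite_induct)
  case empty
  then show ?case using ne by (simp add: within_angle_refl)
next
  case (insert e S)
  obtain w where w: "e = {u, w}"
    using insert.prems(1)[of e] by (metis card_2_iff doubleton_eq_iff insertE insertI1 singletonD)
  have "within_angle (real (card S) * (\<alpha> / 2)) (pinned_sum V E a \<Lambda> \<sigma>) (pinned_sum V (S \<union> E) a \<Lambda> \<sigma>)"
    by (rule insert.IH) (use insert in auto)
  moreover have "within_angle (\<alpha> / 2) (pinned_sum V (S \<union> E) a \<Lambda> \<sigma>) (pinned_sum V (insert e S \<union> E) a \<Lambda> \<sigma>)"
    unfolding w Un_insert_left
    by (rule within_angle_insert_edge[OF V \<Lambda>])
      (use insert E u w in auto)
  ultimately have "within_angle (real (card S) * (\<alpha> / 2) + \<alpha> / 2)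
      (pinned_sum V E a \<Lambda> \<sigma>) (pinned_sum V (insert e S \<union> E) a \<Lambda> \<sigma>)"
    by (rule within_angle_trans)
  then show ?case using insert.hyps by (simp add: field_simps)
qed

text \<open>Deleting all edges at \<open>u\<close> makes the spin at \<open>u\<close> irrelevant;
  restoring at most \<open>\<Delta>\<close> edges turns each of the two sums by at most
  \<open>\<Delta> * \<alpha> / 2\<close>.\<close>

theorem sector_property_bounded_degree:
  fixes V :: "'v set"
  assumes V: "finite V" and E: "finite E" "\<And>e. e \<in> E \<Longrightarrow> e \<subseteq> V \<and> card e = 2"
    and deg: "\<And>v. v \<in> V \<Longrightarrow> card {e \<in> E. v \<in> e} \<le> \<Delta>"
  shows "sector_property (real \<Delta> * \<alpha>) a V E"
  using E deg
proof (induction E rule: finite_psubset_induct)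
  case (psubset E)
  have IH: "sector_property (real \<Delta> * \<alpha>) a V F" if "F \<subset> E" for F
  proof (rule psubset.IH[OF that])
    fix v assume "v \<in> V"
    have "card {e \<in> F. v \<in> e} \<le> card {e \<in> E. v \<in> e}"
      using that psubset.hyps by (intro card_mono) auto
    with psubset.prems(2)[OF \<open>v \<in> V\<close>] show "card {e \<in> F. v \<in> e} \<le> \<Delta>" by simp
  qed (use that psubset.prems in auto)
  have empty: "pinned_sum V {} a \<Lambda> \<sigma> \<noteq> 0" if "\<Lambda> \<subseteq> V" for \<Lambda> and \<sigma> :: "'v \<Rightarrow> 'q"
    using pinned_maps_nonempty[OF that, of \<sigma>] V
    by (simp add: pinned_sum_def finite_pinned_maps)
  \<comment> \<open>An edge at \<open>u\<close> makes \<open>F\<close> below a proper subset of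
    \<open>E\<close>, so nonvanishing comes from the induction hypothesis. For \<open>E\<close>
    itself it is not yet available, as its proof uses this angle bound.\<close>
  have angle: "within_angle (real \<Delta> * \<alpha>) (pinned_sum V E a (insert u \<Lambda>) (\<sigma>(u := k)))
        (pinned_sum V E a (insert u \<Lambda>) (\<sigma>(u := l)))"
    if \<Lambda>: "\<Lambda> \<subseteq> V" and u: "u \<in> V - \<Lambda>" and ne: "{e \<in> E. u \<in> e} \<noteq> {}"
    for \<Lambda> u k l and \<sigma> :: "'v \<Rightarrow> 'q"
  proof -
    define S where "S = {e \<in> E. u \<in> e}"
    define F where "F = {e \<in> E. u \<notin> e}"
    have SF: "S \<union> F = E" "S \<inter> F = {}" "F \<subset> E" using ne by (auto simp: S_def F_def)
    have fin: "finite S" "finite F" using psubset.hyps by (auto simp: S_def F_def)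
    have star: "within_angle (real (card S) * (\<alpha> / 2)) (pinned_sum V F a (insert u \<Lambda>) (\<sigma>(u := m)))
        (pinned_sum V E a (insert u \<Lambda>) (\<sigma>(u := m)))" for m
    proof -
      have "within_angle (real (card S) * (\<alpha> / 2)) (pinned_sum V F a (insert u \<Lambda>) (\<sigma>(u := m)))
        (pinned_sum V (S \<union> F) a (insert u \<Lambda>) (\<sigma>(u := m)))"
      proof (rule within_angle_add_star[OF V _ _ fin(2,1) _ SF(2)])
        show "sector_property (real \<Delta> * \<alpha>) a V (T \<union> F)" if "T \<subset> S" for T
          by (rule IH) (use that SF in blast)
        show "pinned_sum V F a (insert u \<Lambda>) (\<sigma>(u := m)) \<noteq> 0"
          using IH[OF SF(3)] \<Lambda> u by (auto simp: sector_property_def)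
      qed (use \<Lambda> u psubset.prems(1) in \<open>auto simp: S_def\<close>)
      then show ?thesis by (simp only: SF)
    qed
    \<comment> \<open>This common vector is the link between the two sums over
      \<open>E\<close>.\<close>
    have "pinned_sum V F a (insert u \<Lambda>) (\<sigma>(u := k)) = pinned_sum V F a (insert u \<Lambda>) (\<sigma>(u := l))"
      by (rule pinned_sum_isolated) (use u in \<open>auto simp: F_def\<close>)
    then have "within_angle (real (card S) * (\<alpha> / 2) + real (card S) * (\<alpha> / 2))
        (pinned_sum V E a (insert u \<Lambda>) (\<sigma>(u := k))) (pinned_sum V E a (insert u \<Lambda>) (\<sigma>(u := l)))"
      using within_angle_trans[OF within_angle_sym[OF star[of k]]] star[of l] by metis
    moreover have "real (card S) * \<alpha> \<le> real \<Delta> * \<alpha>"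
      using psubset.prems(2)[of u] u \<alpha> by (intro mult_right_mono) (auto simp: S_def)
    ultimately show ?thesis by (elim within_angle_mono) (simp add: field_simps)
  qed
  \<comment> \<open>Any edge \<open>{u, w}\<close> serves: if \<open>u\<close> is pinned, the sum is
    compared with the one lacking that edge; if not, it is split over the spins at \<open>u\<close>,
    where \<open>angle\<close> applies.\<close>
  have nz: "pinned_sum V E a \<Lambda> \<sigma> \<noteq> 0" if \<Lambda>: "\<Lambda> \<subseteq> V" for \<Lambda> and \<sigma> :: "'v \<Rightarrow> 'q"
  proof (cases "E = {}")
    case False
    then obtain u w where e: "{u, w} \<in> E"
      using psubset.prems(1) by (metis card_2_iff ex_in_conv)
    then have uw: "u \<in> V" "w \<in> V" using psubset.prems(1) by auto
    show ?thesis
    proof (cases "u \<in> \<Lambda>")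
      case True
      have "within_angle (\<alpha> / 2) (pinned_sum V (E - {{u, w}}) a \<Lambda> \<sigma>)
          (pinned_sum V (insert {u, w} (E - {{u, w}})) a \<Lambda> \<sigma>)"
        by (rule within_angle_insert_edge[OF V \<Lambda> _ _ True uw(2) IH]) (use psubset.hyps e in auto)
      then show ?thesis using e by (simp add: insert_absorb within_angle_nonzero)
    next
      case False
      show ?thesis
        unfolding pinned_sum_split[OF V False]
        by (rule sum_nonzero, rule angle) (use \<Lambda> uw e False in auto)
    qed
  qed (simp add: empty \<Lambda>)
  have "within_angle (real \<Delta> * \<alpha>) (pinned_sum V E a (insert u \<Lambda>) (\<sigma>(u := k)))
        (pinned_sum V E a (insert u \<Lambda>) (\<sigma>(u := l)))"
    if \<Lambda>: "\<Lambda> \<subseteq> V" and u: "u \<in> V - \<Lambda>" for \<Lambda> u k l and \<sigma> :: "'v \<Rightarrow> 'q"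
  proof (cases "{e \<in> E. u \<in> e} = {}")
    case True
    then have "pinned_sum V E a (insert u \<Lambda>) (\<sigma>(u := k)) = pinned_sum V E a (insert u \<Lambda>) (\<sigma>(u := l))"
      using u by (intro pinned_sum_isolated) auto
    then show ?thesis using nz[of "insert u \<Lambda>"] \<Lambda> u \<alpha> by (simp add: within_angle_refl)
  qed (rule angle[OF \<Lambda> u])
  with nz show ?case unfolding sector_property_def by blast
qed

text \<open>The angle bound gives \<open>\<bar>\<Sum>Z\<^sub>k\<bar> \<ge> cos (\<alpha>\<Delta>/2) \<Sum>\<bar>Z\<^sub>k\<bar>\<close> with \<open>cos (\<alpha>\<Delta>/2) > cos (\<pi>/3) = 1/2\<close>.\<close>

lemma pinned_sum_marginal_le:
  assumes V: "finite V" and sec: "sector_property (real \<Delta> * \<alpha>) a V E"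
    and \<Lambda>: "\<Lambda> \<subseteq> V" and v: "v \<in> V - \<Lambda>"
  shows "cmod (pinned_sum V E a (insert v \<Lambda>) (\<sigma>(v := i)) / pinned_sum V E a \<Lambda> \<sigma>) \<le> 2"
proof -
  define X where "X k = pinned_sum V E a (insert v \<Lambda>) (\<sigma>(v := k))" for k
  have sum_X: "pinned_sum V E a \<Lambda> \<sigma> = (\<Sum>k\<in>UNIV. X k)"
    unfolding X_def by (rule pinned_sum_split) (use V v in auto)
  have nz: "pinned_sum V E a \<Lambda> \<sigma> \<noteq> 0" using sec \<Lambda> by (simp add: sector_property_def)
  have "1 / 2 * cmod (X i) \<le> cos (\<alpha> * real \<Delta> / 2) * cmod (X i)"
    using cos_gt_half by (intro mult_right_mono) auto
  also have "\<dots> \<le> cos (\<alpha> * real \<Delta> / 2) * (\<Sum>k\<in>UNIV. cmod (X k))"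
    using cos_gt_half by (intro mult_left_mono member_le_sum) auto
  also have "\<dots> \<le> cmod (\<Sum>k\<in>UNIV. X k)"
  proof (rule norm_sum_ge)
    show "within_angle (real \<Delta> * \<alpha>) (X k) (X l)" for k l
      using sec \<Lambda> v unfolding sector_property_def X_def by blast
  qed
  finally have "cmod (X i) \<le> 2 * cmod (pinned_sum V E a \<Lambda> \<sigma>)" by (simp add: sum_X)
  then show ?thesis using nz by (simp add: norm_divide divide_le_eq X_def)
qed

end

subsection \<open>Low-order terms do not see distant disagreements\<close>

text \<open>Stated for a bare edge set, unlike \<open>adj\<close>, to apply to the edges selected in
  a term of the expansion.\<close>

definition edge_rel :: "'v set set \<Rightarrow> 'v rel" where
  "edge_rel U = {(x, y). {x, y} \<in> U}"

lemma edge_rel_relpow_mono: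
  assumes "U \<subseteq> W"
  shows "edge_rel U ^^ n \<subseteq> edge_rel W ^^ n"
proof (induction n)
  case (Suc n)
  have "edge_rel U \<subseteq> edge_rel W" using assms by (auto simp: edge_rel_def)
  with Suc show ?case by (auto intro: relcomp_mono[THEN subsetD])
qed simp

text \<open>Along a shortest walk the edges have distinct distances from the start, so its length is at most
  the number of (undirected) edges.\<close>

lemma reachable_imp_short_walk:
  assumes U: "finite U" and vx: "(v, x) \<in> (edge_rel U)\<^sup>*"
  shows "\<exists>n\<le>card U. (v, x) \<in> edge_rel U ^^ n"
proof -
  define N where "N y = (LEAST n. (v, y) \<in> edge_rel U ^^ n)" for y
  \<comment> \<open>The label of an edge on a shortest walk is the distance of its endpoint nearer
    to \<open>v\<close>; all labels below \<open>N x\<close> occur along a shortest walk to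
    \<open>x\<close>.\<close>
  define lab where "lab e = Min (N ` e)" for e
  have N_le: "N y \<le> n" if "(v, y) \<in> edge_rel U ^^ n" for y n
    unfolding N_def using that by (rule Least_le)
  have N: "(v, y) \<in> edge_rel U ^^ N y" if "(v, y) \<in> edge_rel U ^^ n" for y n
    unfolding N_def using that by (rule LeastI)
  have "{..<n} \<subseteq> lab ` U" if "(v, y) \<in> edge_rel U ^^ n" "N y = n" for n y
    using that
  proof (induction n arbitrary: y)
    case (Suc n)
    then obtain w where w: "(v, w) \<in> edge_rel U ^^ n" "(w, y) \<in> edge_rel U" by auto
    have "N y \<le> Suc (N w)"
      by (rule N_le) (use N[OF w(1)] w(2) in auto)
    with N_le[OF w(1)] Suc.prems have Nw: "N w = n" by simp
    have "lab {w, y} = n" by (simp add: lab_def Nw Suc.prems)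
    moreover have "{w, y} \<in> U" using w(2) by (simp add: edge_rel_def)
    ultimately have "n \<in> lab ` U" by force
    with Suc.IH[OF w(1) Nw] show ?case by (auto simp: less_Suc_eq)
  qed simp
  moreover obtain n where "(v, x) \<in> edge_rel U ^^ n" using vx rtrancl_imp_relpow by metis
  ultimately have "{..<N x} \<subseteq> lab ` U" and walk: "(v, x) \<in> edge_rel U ^^ N x" using N by blast+
  then have "card {..<N x} \<le> card U" using U by (meson surj_card_le)
  with walk show ?thesis by auto
qed

definition cluster :: "'v \<Rightarrow> 'v set set \<Rightarrow> 'v set" where
  "cluster v U = {x. (v, x) \<in> (edge_rel U)\<^sup>*}"

text \<open>A component cannot cut one of its edges; hence the exchange below can move every edge as
  a whole.\<close>

lemma cluster_closed:
  assumes "e \<in> U" "card e = 2"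
  shows "e \<subseteq> cluster v U \<or> e \<inter> cluster v U = {}"
proof -
  obtain x y where e: "e = {x, y}" using assms(2) by (auto simp: card_2_iff)
  then have "(x, y) \<in> edge_rel U" "(y, x) \<in> edge_rel U"
    using assms(1) by (auto simp: edge_rel_def insert_commute)
  then show ?thesis unfolding e cluster_def by (auto intro: rtrancl_into_rtrancl)
qed

section \<open>Terms of a product of two expansions, and their exchange off a cluster\<close>

type_synonym ('v, 'q) expansion_term = "('v \<Rightarrow> 'q) \<times> ('v \<Rightarrow> 'q) \<times> 'v set set \<times> 'v set set"

text \<open>\<open>S\<close> and \<open>T\<close> are the edges that contribute \<open>z * b\<close>
  and not 1 in the first and the second sum; the order is the resulting power of
  \<open>z\<close>.\<close>

fun term_order :: "('v, 'q) expansion_term \<Rightarrow> nat" where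
  "term_order (\<psi>, \<phi>, S, T) = card S + card T"

fun term_coeff :: "('q \<Rightarrow> 'q \<Rightarrow> complex) \<Rightarrow> ('v, 'q) expansion_term \<Rightarrow> complex" where
  "term_coeff b (\<psi>, \<phi>, S, T) = (\<Prod>e\<in>S. edge_val b \<psi> e) * (\<Prod>e\<in>T. edge_val b \<phi> e)"

text \<open>Exchange the two configurations, together with their edges, off the cluster of \<open>v\<close>. If the
  cluster does not reach a disagreement of the boundary conditions, this exchanges the boundary
  conditions.\<close>

fun cluster_swap :: "'v \<Rightarrow> ('v, 'q) expansion_term \<Rightarrow> ('v, 'q) expansion_term" where
  "cluster_swap v (\<psi>, \<phi>, S, T) = (let C = cluster v (S \<union> T) in
     (\<lambda>x. if x \<in> C then \<psi> x else \<phi> x, \<lambda>x. if x \<in> C then \<phi> x else \<psi> x,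
      {e \<in> S. e \<subseteq> C} \<union> {e \<in> T. \<not> e \<subseteq> C}, {e \<in> T. e \<subseteq> C} \<union> {e \<in> S. \<not> e \<subseteq> C}))"

text \<open>The exchange preserves \<open>S \<union> T\<close>, so the second application recomputes
  the same cluster.\<close>

lemma cluster_swap_involution: "cluster_swap v (cluster_swap v x) = x"
proof (cases x)
  case (fields \<psi> \<phi> S T)
  define C where "C = cluster v (S \<union> T)"
  have "{e \<in> S. e \<subseteq> C} \<union> {e \<in> T. \<not> e \<subseteq> C} \<union> ({e \<in> T. e \<subseteq> C} \<union> {e \<in> S. \<not> e \<subseteq> C}) = S \<union> T"
    by auto
  then have "cluster v ({e \<in> S. e \<subseteq> C} \<union> {e \<in> T. \<not> e \<subseteq> C} \<union> ({e \<in> T. e \<subseteq> C} \<union> {e \<in> S. \<not> e \<subseteq> C})) = C"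
    by (simp add: C_def)
  then show ?thesis
    unfolding fields cluster_swap.simps Let_def C_def[symmetric] by (auto simp: fun_eq_iff)
qed

text \<open>Each new edge set consists of edges inside the cluster and edges not inside it; these
  are disjoint, so the cardinalities add even if \<open>S\<close> and \<open>T\<close>
  overlap.\<close>

lemma term_order_cluster_swap:
  assumes "finite S" "finite T"
  shows "term_order (cluster_swap v (\<psi>, \<phi>, S, T)) = term_order (\<psi>, \<phi>, S, T)"
proof -
  have un: "card ({e \<in> A. P e} \<union> {e \<in> B. \<not> P e}) = card {e \<in> A. P e} + card {e \<in> B. \<not> P e}"
    if "finite A" "finite B" for A B :: "'a set set" and P
    using that by (intro card_Un_disjoint) auto
  have "card A = card {e \<in> A. P e} + card {e \<in> A. \<not> P e}"
    if "finite A" for A :: "'a set set" and P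
    using that by (subst card_Un_disjoint[symmetric]) (auto intro!: arg_cong[where f = card])
  note this[OF assms(1), of "\<lambda>e. e \<subseteq> cluster v (S \<union> T)"] this[OF assms(2), of "\<lambda>e. e \<subseteq> cluster v (S \<union> T)"]
  then show ?thesis
    using assms by (simp add: Let_def un)
qed

text \<open>Each edge lies inside the cluster or misses it, so both its endpoints still take their
  spins from the configuration the edge came with.\<close>

lemma term_coeff_cluster_swap:
  assumes fin: "finite S" "finite T" and card2: "\<And>e. e \<in> S \<union> T \<Longrightarrow> card e = 2"
  shows "term_coeff b (cluster_swap v (\<psi>, \<phi>, S, T)) = term_coeff b (\<psi>, \<phi>, S, T)"
proof -
  define C where "C = cluster v (S \<union> T)"
  have disj: "e \<inter> C = {}" if "e \<in> S \<union> T" "\<not> e \<subseteq> C" for e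
    using cluster_closed[OF that(1) card2[OF that(1)], of v] that(2) by (simp add: C_def)
  have split: "(\<Prod>e\<in>{e \<in> A. e \<subseteq> C} \<union> {e \<in> B. \<not> e \<subseteq> C}. edge_val b (\<lambda>x. if x \<in> C then f x else g x) e)
      = (\<Prod>e\<in>{e \<in> A. e \<subseteq> C}. edge_val b f e) * (\<Prod>e\<in>{e \<in> B. \<not> e \<subseteq> C}. edge_val b g e)"
    if "finite A" "finite B" "A \<subseteq> S \<union> T" "B \<subseteq> S \<union> T" for A B and f g :: "'a \<Rightarrow> 'b"
  proof (subst prod.union_disjoint)
    show "(\<Prod>e\<in>{e \<in> A. e \<subseteq> C}. edge_val b (\<lambda>x. if x \<in> C then f x else g x) e) *
          (\<Prod>e\<in>{e \<in> B. \<not> e \<subseteq> C}. edge_val b (\<lambda>x. if x \<in> C then f x else g x) e)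
      = (\<Prod>e\<in>{e \<in> A. e \<subseteq> C}. edge_val b f e) * (\<Prod>e\<in>{e \<in> B. \<not> e \<subseteq> C}. edge_val b g e)"
      using disj that(4)
      by (intro arg_cong2[where f = "(*)"] prod.cong refl edge_val_cong) auto
  qed (use that in auto)
  have whole: "(\<Prod>e\<in>A. h e) = (\<Prod>e\<in>{e \<in> A. e \<subseteq> C}. h e) * (\<Prod>e\<in>{e \<in> A. \<not> e \<subseteq> C}. h e)"
    if "finite A" for A and h :: "'a set \<Rightarrow> complex"
    using that by (subst prod.union_disjoint[symmetric]) (auto intro!: prod.cong)
  show ?thesis
    unfolding cluster_swap.simps Let_def C_def[symmetric] term_coeff.simps
    by (subst (1 2) split) (use fin in \<open>auto simp: whole[of S] whole[of T] mult_ac\<close>)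
qed

section \<open>Expansion in powers of \<open>z\<close> and cancellation of low orders\<close>

lemma prod_one_plus_expansion:
  fixes x :: "'e \<Rightarrow> complex"
  assumes "finite E"
  shows "(\<Prod>e\<in>E. 1 + z * x e) = (\<Sum>S\<in>Pow E. z ^ card S * (\<Prod>e\<in>S. x e))"
proof -
  have "(\<Prod>e\<in>E. 1 + z * x e) = (\<Prod>e\<in>E. z * x e + 1)" by (simp add: add.commute)
  also have "\<dots> = (\<Sum>S\<in>Pow E. z ^ card S * (\<Prod>e\<in>S. x e))"
    by (subst prod_add[OF assms]) (simp add: prod.distrib)
  finally show ?thesis .
qed

lemma pinned_sum_expansion:
  assumes E: "finite E" "\<And>e. e \<in> E \<Longrightarrow> card e = 2" and b: "\<And>i j. b i j = b j i"
  shows "pinned_sum V E (\<lambda>i j. 1 + z * b i j) \<Lambda> \<sigma>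
    = (\<Sum>\<psi>\<in>pinned_maps V \<Lambda> \<sigma>. \<Sum>S\<in>Pow E. z ^ card S * (\<Prod>e\<in>S. edge_val b \<psi> e))"
  unfolding pinned_sum_def
proof (rule sum.cong[OF refl])
  fix \<psi>
  have "edge_val (\<lambda>i j. 1 + z * b i j) \<psi> e = 1 + z * edge_val b \<psi> e" if e: "e \<in> E" for e
  proof -
    obtain u v where "e = {u, v}" using E(2)[OF e] by (auto simp: card_2_iff)
    then show ?thesis by (simp add: edge_val_doubleton b)
  qed
  then show "(\<Prod>e\<in>E. edge_val (\<lambda>i j. 1 + z * b i j) \<psi> e)
      = (\<Sum>S\<in>Pow E. z ^ card S * (\<Prod>e\<in>S. edge_val b \<psi> e))"
    by (simp add: prod_one_plus_expansion[OF E(1)])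
qed

definition expansion_terms ::
    "'v set \<Rightarrow> 'v set set \<Rightarrow> 'v set \<Rightarrow> ('v \<Rightarrow> 'q) \<Rightarrow> 'v set \<Rightarrow> ('v \<Rightarrow> 'q) \<Rightarrow> ('v, 'q) expansion_term set" where
  "expansion_terms V E \<Lambda> \<sigma> M \<tau> = pinned_maps V \<Lambda> \<sigma> \<times> pinned_maps V M \<tau> \<times> Pow E \<times> Pow E"

lemma pinned_sum_mult_expansion:
  assumes E: "finite E" "\<And>e. e \<in> E \<Longrightarrow> card e = 2" and b: "\<And>i j. b i j = b j i"
  shows "pinned_sum V E (\<lambda>i j. 1 + z * b i j) \<Lambda> \<sigma> * pinned_sum V E (\<lambda>i j. 1 + z * b i j) M \<tau>
    = (\<Sum>x\<in>expansion_terms V E \<Lambda> \<sigma> M \<tau>. z ^ term_order x * term_coeff b x)"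
proof -
  note e = pinned_sum_expansion[where b = b and V = V and z = z, OF E b]
  have "pinned_sum V E (\<lambda>i j. 1 + z * b i j) \<Lambda> \<sigma> * pinned_sum V E (\<lambda>i j. 1 + z * b i j) M \<tau>
     = (\<Sum>\<psi>\<in>pinned_maps V \<Lambda> \<sigma>. \<Sum>\<phi>\<in>pinned_maps V M \<tau>. \<Sum>S\<in>Pow E. \<Sum>T\<in>Pow E.
         z ^ card S * (\<Prod>e\<in>S. edge_val b \<psi> e) * (z ^ card T * (\<Prod>e\<in>T. edge_val b \<phi> e)))"
    by (simp only: e sum_product)
  also have "\<dots> = (\<Sum>\<psi>\<in>pinned_maps V \<Lambda> \<sigma>. \<Sum>\<phi>\<in>pinned_maps V M \<tau>. \<Sum>S\<in>Pow E. \<Sum>T\<in>Pow E.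
         z ^ term_order (\<psi>, \<phi>, S, T) * term_coeff b (\<psi>, \<phi>, S, T))"
    by (simp add: power_add mult_ac)
  also have "\<dots> = (\<Sum>x\<in>expansion_terms V E \<Lambda> \<sigma> M \<tau>. z ^ term_order x * term_coeff b x)"
    unfolding expansion_terms_def by (simp only: sum.cartesian_product split_def prod.collapse)
  finally show ?thesis .
qed

text \<open>The cluster has at most \<open>term_order x < d\<close> edges available, too few to
  reach a disagreement. So \<open>\<sigma>\<close> and \<open>\<tau>\<close> agree on it, and the
  exchange off it trades the boundary conditions, while \<open>v\<close> lies in the cluster and
  keeps its spin.\<close>

lemma cluster_swap_expansion_terms:
  assumes E: "finite E" and v: "v \<notin> \<Lambda>"
    and far: "\<And>u n. u \<in> \<Lambda> \<Longrightarrow> \<sigma> u \<noteq> \<tau> u \<Longrightarrow> n < d \<Longrightarrow> (v, u) \<notin> edge_rel E ^^ n"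
    and x: "x \<in> expansion_terms V E (insert v \<Lambda>) (\<sigma>(v := i)) \<Lambda> \<tau>" "term_order x < d"
  shows "cluster_swap v x \<in> expansion_terms V E (insert v \<Lambda>) (\<tau>(v := i)) \<Lambda> \<sigma>"
proof (cases x)
  case (fields \<psi> \<phi> S T)
  define C where "C = cluster v (S \<union> T)"
  have ST: "S \<subseteq> E" "T \<subseteq> E" and maps: "\<psi> \<in> V \<rightarrow>\<^sub>E UNIV" "\<phi> \<in> V \<rightarrow>\<^sub>E UNIV" "\<psi> v = i"
    using x(1) by (auto simp: fields expansion_terms_def pinned_maps_def)
  have \<psi>: "\<psi> u = \<sigma> u" and \<phi>: "\<phi> u = \<tau> u" if "u \<in> \<Lambda>" for u
    using x(1) v that by (auto simp: fields expansion_terms_def pinned_maps_def)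
  have agree: "\<sigma> u = \<tau> u" if u: "u \<in> \<Lambda>" "u \<in> C" for u
  proof (rule ccontr)
    assume "\<sigma> u \<noteq> \<tau> u"
    have fin: "finite (S \<union> T)" using E ST by (meson finite_Un finite_subset)
    obtain n where n: "n \<le> card (S \<union> T)" "(v, u) \<in> edge_rel (S \<union> T) ^^ n"
      using reachable_imp_short_walk[OF fin, of v u] u(2) by (auto simp: C_def cluster_def)
    have "n < d" using n(1) card_Un_le[of S T] x(2) fields by simp
    moreover have "(v, u) \<in> edge_rel E ^^ n"
      using n(2) ST edge_rel_relpow_mono[of "S \<union> T" E] by blast
    ultimately show False using far[OF u(1) \<open>\<sigma> u \<noteq> \<tau> u\<close>] by blast
  qed
  have "v \<in> C" by (simp add: C_def cluster_def)
  then show ?thesis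
    using maps ST \<psi> \<phi> agree v
    unfolding fields cluster_swap.simps Let_def C_def[symmetric]
    by (auto simp: expansion_terms_def pinned_maps_def PiE_def extensional_def)
qed

text \<open>The left side is the numerator of the difference of the two marginals. The exchange
  matches the terms of order below \<open>d\<close> in both products, and all others contain
  \<open>z ^ d\<close>.\<close>

lemma pinned_sum_cross_difference:
  fixes V :: "'v set" and \<sigma> :: "'v \<Rightarrow> 'q::finite"
  assumes V: "finite V" and E: "finite E" "\<And>e. e \<in> E \<Longrightarrow> card e = 2"
    and b: "\<And>i j. b i j = b j i" and v: "v \<notin> \<Lambda>"
    and far: "\<And>u n. u \<in> \<Lambda> \<Longrightarrow> \<sigma> u \<noteq> \<tau> u \<Longrightarrow> n < d \<Longrightarrow> (v, u) \<notin> edge_rel E ^^ n"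
  defines "Z \<equiv> \<lambda>z. pinned_sum V E (\<lambda>i j. 1 + z * b i j)"
  obtains g where "g holomorphic_on UNIV"
    and "\<And>z. Z z (insert v \<Lambda>) (\<sigma>(v := i)) * Z z \<Lambda> \<tau> - Z z (insert v \<Lambda>) (\<tau>(v := i)) * Z z \<Lambda> \<sigma> = z ^ d * g z"
proof
  define X where "X = expansion_terms V E (insert v \<Lambda>) (\<sigma>(v := i)) \<Lambda> \<tau>"
  define Y where "Y = expansion_terms V E (insert v \<Lambda>) (\<tau>(v := i)) \<Lambda> \<sigma>"
  \<comment> \<open>The part of order at least \<open>d\<close>, with \<open>z ^ d\<close> divided
    out; the filter makes the natural subtraction exact.\<close>
  define H where "H A z = (\<Sum>x\<in>{x \<in> A. \<not> term_order x < d}. z ^ (term_order x - d) * term_coeff b x)"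
    for A :: "('v, 'q) expansion_term set" and z :: complex
  have fin: "finite X" "finite Y"
    using V E by (auto simp: X_def Y_def expansion_terms_def finite_pinned_maps)
  show "(\<lambda>z. H X z - H Y z) holomorphic_on UNIV"
    unfolding H_def by (intro holomorphic_intros)
  \<comment> \<open>The same hypothesis with the boundary conditions interchanged, for the inverse
    direction of the bijection.\<close>
  have far': "(v, u) \<notin> edge_rel E ^^ n" if "u \<in> \<Lambda>" "\<tau> u \<noteq> \<sigma> u" "n < d" for u n
    using far[of u n] that by metis
  fix z
  have high: "(\<Sum>x\<in>{x \<in> A. \<not> term_order x < d}. z ^ term_order x * term_coeff b x) = z ^ d * H A z" for A
    unfolding H_def sum_distrib_left
    by (intro sum.cong refl) (simp add: mult.assoc[symmetric] flip: power_add)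
  have split: "(\<Sum>x\<in>A. z ^ term_order x * term_coeff b x)
      = (\<Sum>x\<in>{x \<in> A. term_order x < d}. z ^ term_order x * term_coeff b x) + z ^ d * H A z"
    if "finite A" for A
    unfolding high[symmetric] using that
    by (subst sum.union_disjoint[symmetric]) (auto intro!: sum.cong)
  have low: "(\<Sum>x\<in>{x \<in> X. term_order x < d}. z ^ term_order x * term_coeff b x)
      = (\<Sum>x\<in>{x \<in> Y. term_order x < d}. z ^ term_order x * term_coeff b x)"
  proof (rule sum.reindex_bij_witness[where i = "cluster_swap v" and j = "cluster_swap v"])
    have inv: "term_order (cluster_swap v x) = term_order x"
      "term_coeff b (cluster_swap v x) = term_coeff b x" if "x \<in> X \<union> Y" for x
    proof -
      obtain \<psi> \<phi> S T where x: "x = (\<psi>, \<phi>, S, T)" by (cases x)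
      have "S \<subseteq> E" "T \<subseteq> E" using that by (auto simp: x X_def Y_def expansion_terms_def)
      then show "term_order (cluster_swap v x) = term_order x"
        "term_coeff b (cluster_swap v x) = term_coeff b x"
        unfolding x using E by (auto intro!: term_order_cluster_swap term_coeff_cluster_swap
            intro: finite_subset simp del: cluster_swap.simps term_order.simps term_coeff.simps)
    qed
    show "cluster_swap v x \<in> {x \<in> Y. term_order x < d}" if "x \<in> {x \<in> X. term_order x < d}" for x
      using that inv cluster_swap_expansion_terms[OF E(1) v far, where d = d and x = x and V = V and i = i]
      by (auto simp: X_def Y_def)
    show "cluster_swap v x \<in> {x \<in> X. term_order x < d}" if "x \<in> {x \<in> Y. term_order x < d}" for x
      using that inv cluster_swap_expansion_terms[OF E(1) v far', where d = d and x = x and V = V and i = i]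
      by (auto simp: X_def Y_def)
    show "z ^ term_order (cluster_swap v x) * term_coeff b (cluster_swap v x) = z ^ term_order x * term_coeff b x"
      if "x \<in> {x \<in> X. term_order x < d}" for x
      using that inv by simp
  qed (simp_all add: cluster_swap_involution)
  have "Z z (insert v \<Lambda>) (\<sigma>(v := i)) * Z z \<Lambda> \<tau> - Z z (insert v \<Lambda>) (\<tau>(v := i)) * Z z \<Lambda> \<sigma>
      = (\<Sum>x\<in>X. z ^ term_order x * term_coeff b x) - (\<Sum>x\<in>Y. z ^ term_order x * term_coeff b x)"
    unfolding Z_def X_def Y_def by (simp only: pinned_sum_mult_expansion[where b = b, OF E b])
  also have "\<dots> = z ^ d * (H X z - H Y z)"
    unfolding split[OF fin(1)] split[OF fin(2)] low by (simp add: right_diff_distrib)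
  finally show "Z z (insert v \<Lambda>) (\<sigma>(v := i)) * Z z \<Lambda> \<tau> - Z z (insert v \<Lambda>) (\<tau>(v := i)) * Z z \<Lambda> \<sigma>
      = z ^ d * (H X z - H Y z)" .
qed

subsection \<open>Decay of correlations\<close>

lemma holomorphic_pinned_sum:
  assumes E: "finite E" "\<And>e. e \<in> E \<Longrightarrow> card e = 2" and b: "\<And>i j. b i j = b j i"
  shows "(\<lambda>z. pinned_sum V E (\<lambda>i j. 1 + z * b i j) \<Lambda> \<sigma>) holomorphic_on S"
  by (simp only: pinned_sum_expansion[where b = b, OF E b]) (intro holomorphic_intros)

text \<open>A Schwarz lemma argument on the disk of radius \<open>r\<close>; the constant 4 is the
  sum of the bounds 2 for the two marginals.\<close>

theorem marginal_difference_decay: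
  fixes V :: "'v set" and b :: "'q::finite \<Rightarrow> 'q \<Rightarrow> complex" and i :: 'q
  assumes V: "finite V" and E: "finite E" "\<And>e. e \<in> E \<Longrightarrow> e \<subseteq> V \<and> card e = 2"
    and deg: "\<And>v. v \<in> V \<Longrightarrow> card {e \<in> E. v \<in> e} \<le> \<Delta>"
    and \<alpha>: "0 < \<alpha>" "real \<Delta> * \<alpha> < 2 * pi / 3" and \<Delta>: "\<Delta> \<ge> 3" and r: "1 \<le> r"
    and b: "\<And>i j. b i j = b j i" "\<And>i j. r * cmod (b i j) \<le> sin (\<alpha> / 2) * cos (\<alpha> * real \<Delta> / 2)"
    and \<Lambda>: "\<Lambda> \<subseteq> V" and v: "v \<in> V - \<Lambda>"
    and far: "\<And>u n. u \<in> \<Lambda> \<Longrightarrow> \<sigma> u \<noteq> \<tau> u \<Longrightarrow> n < d \<Longrightarrow> (v, u) \<notin> edge_rel E ^^ n"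
  defines "Z \<equiv> pinned_sum V E (\<lambda>i j. 1 + b i j)"
  shows "cmod (Z (insert v \<Lambda>) (\<sigma>(v := i)) / Z \<Lambda> \<sigma> - Z (insert v \<Lambda>) (\<tau>(v := i)) / Z \<Lambda> \<tau>) \<le> 4 / r ^ d"
proof -
  define P where "P z = pinned_sum V E (\<lambda>i j. 1 + z * b i j)" for z
  define F where "F z = P z (insert v \<Lambda>) (\<sigma>(v := i)) / P z \<Lambda> \<sigma> - P z (insert v \<Lambda>) (\<tau>(v := i)) / P z \<Lambda> \<tau>"
    for z
  have vL: "v \<notin> \<Lambda>" using v by simp
  have card2: "\<And>e. e \<in> E \<Longrightarrow> card e = 2" using E(2) by blast
  have weights: "barvinok_weights (\<lambda>i j. 1 + z * b i j) \<alpha> \<Delta>" if z: "cmod z \<le> r" for z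
  proof
    fix i j
    have "cmod z * cmod (b i j) \<le> r * cmod (b i j)" using z by (rule mult_right_mono) simp
    also note b(2)
    finally show "cmod (1 + z * b i j - 1) \<le> sin (\<alpha> / 2) * cos (\<alpha> * real \<Delta> / 2)"
      by (simp add: norm_mult)
  qed (use \<alpha> \<Delta> b(1) in auto)
  have sec: "sector_property (real \<Delta> * \<alpha>) (\<lambda>i j. 1 + z * b i j) V E" if "cmod z \<le> r" for z
    using barvinok_weights.sector_property_bounded_degree[OF weights[OF that] V E deg] .
  have nz: "P z \<Lambda> \<phi> \<noteq> 0" if "cmod z \<le> r" for z \<phi>
    using sec[OF that] \<Lambda> by (simp add: P_def sector_property_def)
  have F_le: "cmod (F z) \<le> 4" if "cmod z \<le> r" for z
  proof -
    have "cmod (P z (insert v \<Lambda>) (\<phi>(v := i)) / P z \<Lambda> \<phi>) \<le> 2" for \<phi>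
      unfolding P_def
      using barvinok_weights.pinned_sum_marginal_le[OF weights[OF that] V sec[OF that] \<Lambda> v] .
    from this[of \<sigma>] this[of \<tau>] show ?thesis
      unfolding F_def by (rule order_trans[OF norm_triangle_ineq4 add_mono, THEN order_trans]) simp
  qed
  obtain g where g: "g holomorphic_on UNIV"
    and cross: "\<And>z. P z (insert v \<Lambda>) (\<sigma>(v := i)) * P z \<Lambda> \<tau> - P z (insert v \<Lambda>) (\<tau>(v := i)) * P z \<Lambda> \<sigma>
      = z ^ d * g z"
    unfolding P_def
    using pinned_sum_cross_difference[where d = d and i = i and b = b, OF V E(1) card2 b(1) vL far] by metis
  \<comment> \<open>This is \<open>F z / z ^ d\<close>, written through \<open>g\<close> so that it
    is holomorphic at 0 as well.\<close>
  define h where "h z = g z / (P z \<Lambda> \<sigma> * P z \<Lambda> \<tau>)" for z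
  have F_eq: "F z = z ^ d * h z" if "cmod z \<le> r" for z
    using nz[OF that] cross[of z, symmetric] by (simp add: F_def h_def field_simps)
  have h: "h holomorphic_on cball 0 r"
    unfolding h_def using nz unfolding P_def
    by (intro holomorphic_intros holomorphic_pinned_sum E(1) card2 b(1) holomorphic_on_subset[OF g]) auto
  have "cmod (h 1) \<le> 4 / r ^ d"
  proof (rule maximum_modulus_frontier[of h "cball 0 r"])
    show "h holomorphic_on interior (cball 0 r)"
      using h by (rule holomorphic_on_subset) (rule interior_subset)
    show "continuous_on (closure (cball 0 r)) h"
      using holomorphic_on_imp_continuous_on[OF h] by simp
    show "cmod (h z) \<le> 4 / r ^ d" if "z \<in> frontier (cball 0 r)" for z
    proof -
      have "cmod z = r" using that r by (simp add: frontier_cball)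
      then show ?thesis
        using F_eq[of z] F_le[of z] r by (simp add: norm_mult norm_power field_simps)
    qed
  qed (use r in auto)
  moreover have "F 1 = h 1" using F_eq[of 1] r by simp
  moreover have "F 1 = Z (insert v \<Lambda>) (\<sigma>(v := i)) / Z \<Lambda> \<sigma> - Z (insert v \<Lambda>) (\<tau>(v := i)) / Z \<Lambda> \<tau>"
    by (simp add: F_def P_def Z_def)
  ultimately show ?thesis by simp
qed

section \<open>From the measure to quotients of pinned sums\<close>

lemma of_real_hom_weight:
  assumes G: "simple_graph G" and A: "transpose A = A"
  shows "complex_of_real (hom_weight G A \<psi>) = (\<Prod>e\<in>edges G. edge_val (\<lambda>i j. of_real (A $ i $ j)) \<psi> e)"
  unfolding hom_weight_def of_real_prod
proof (rule prod.cong[OF refl])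
  fix e assume "e \<in> edges G"
  then obtain u v where e: "e = {u, v}"
    using G unfolding simple_graph_def by (meson card_2_iff)
  have "A $ i $ j = A $ j $ i" for i j
    by (metis A transpose_def vec_lambda_beta)
  then show "complex_of_real (edge_weight A \<psi> e) = edge_val (\<lambda>i j. of_real (A $ i $ j)) \<psi> e"
    unfolding e by (simp add: edge_weight_doubleton[OF A] edge_val_doubleton)
qed

lemma prob_hom_measure:
  assumes G: "simple_graph G" and A: "transpose A = A" and pos: "\<And>i j. A $ i $ j > 0"
    and S: "S \<subseteq> verts G \<rightarrow>\<^sub>E UNIV"
  shows "measure (hom_measure G A) S = (\<Sum>\<psi>\<in>S. hom_weight G A \<psi>) / partition_function G A"
proof -
  have "finite (verts G \<rightarrow>\<^sub>E (UNIV :: 'b set))"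
    using G by (auto simp: simple_graph_def intro: finite_PiE)
  moreover have "0 \<le> hom_weight G A \<psi> / partition_function G A" for \<psi>
    using hom_weight_pos[OF G A pos] partition_function_pos[OF G A pos] by (simp add: less_imp_le)
  ultimately show ?thesis
    unfolding hom_measure_def using S by (simp add: measure_point_measure_finite_if sum_divide_distrib)
qed

lemma cond_prob_hom_measure:
  fixes A :: "real^'q::finite^'q"
  assumes G: "simple_graph G" and A: "transpose A = A" and pos: "\<And>i j. A $ i $ j > 0"
    and \<Lambda>: "\<Lambda> \<subseteq> verts G - {v}" and \<sigma>: "\<sigma> \<in> \<Lambda> \<rightarrow>\<^sub>E UNIV"
  defines "Z \<equiv> pinned_sum (verts G) (edges G) (\<lambda>i j. of_real (A $ i $ j))"
  shows "complex_of_real (\<P>(\<psi> in hom_measure G A. \<psi> v = i \<bar> boundary_event \<Lambda> \<sigma> \<psi>))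
    = Z (insert v \<Lambda>) (\<sigma>(v := i)) / Z \<Lambda> \<sigma>"
proof -
  have space: "space (hom_measure G A) = verts G \<rightarrow>\<^sub>E UNIV"
    by (simp add: hom_measure_def space_point_measure)
  \<comment> \<open>Off \<open>\<Lambda>\<close> both \<open>\<sigma>\<close> and the restriction of
    \<open>\<psi>\<close> are \<open>undefined\<close>, so equality of functions reduces to
    agreement on \<open>\<Lambda>\<close>.\<close>
  have event: "boundary_event \<Lambda> \<sigma> \<psi> \<longleftrightarrow> (\<forall>u\<in>\<Lambda>. \<psi> u = \<sigma> u)" for \<psi> :: "'a \<Rightarrow> 'q"
    using \<sigma> unfolding boundary_event_def by (auto simp: fun_eq_iff restrict_def PiE_def extensional_def)
  have sets: "{\<psi> \<in> space (hom_measure G A). boundary_event \<Lambda> \<sigma> \<psi>} = pinned_maps (verts G) \<Lambda> \<sigma>"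
    "{\<psi> \<in> space (hom_measure G A). \<psi> v = i \<and> boundary_event \<Lambda> \<sigma> \<psi>}
      = pinned_maps (verts G) (insert v \<Lambda>) (\<sigma>(v := i))"
    using \<Lambda> unfolding space event pinned_maps_def by fastforce+
  have prob: "complex_of_real (measure (hom_measure G A) (pinned_maps (verts G) M \<phi>))
      = Z M \<phi> / of_real (partition_function G A)" for M \<phi>
  proof -
    have "pinned_maps (verts G) M \<phi> \<subseteq> verts G \<rightarrow>\<^sub>E UNIV" by (auto simp: pinned_maps_def)
    then show ?thesis
      by (simp add: prob_hom_measure[OF G A pos] Z_def pinned_sum_def of_real_hom_weight[OF G A])
  qed
  show ?thesis
    unfolding cond_prob_def sets of_real_divide prob
    using partition_function_pos[OF G A pos] by simp
qed

lemma adj_relpow_disagreement_dist: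
  assumes "u \<in> \<Lambda>" "\<sigma> u \<noteq> \<tau> u" "(v, u) \<in> adj G ^^ n"
  shows "disagreement_dist G v \<Lambda> \<sigma> \<tau> \<le> enat n"
proof -
  have "disagreement_dist G v \<Lambda> \<sigma> \<tau> \<le> graph_dist G v u"
    unfolding disagreement_dist_def using assms by (intro INF_lower) auto
  also have "\<dots> \<le> enat n" unfolding graph_dist_def using assms by (intro INF_lower) auto
  finally show ?thesis .
qed

text \<open>At infinite distance the bound holds for every \<open>n\<close>, and the limit forces
  \<open>x \<le> 0\<close>. This treats finite and infinite distances by one estimate.\<close>

lemma le_exp_decayI:
  assumes r: "1 < r" and le: "\<And>n. enat n \<le> d \<Longrightarrow> x \<le> C / r ^ n"
  shows "x \<le> C * exp_decay r d"
proof (cases d)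
  case (enat n)
  then show ?thesis
    using le[of n] by (simp add: exp_decay_def power_int_minus field_simps)
next
  case infinity
  have "(\<lambda>n. C * inverse (r ^ n)) \<longlonglongrightarrow> C * 0"
    by (intro tendsto_intros LIMSEQ_inverse_realpow_zero r)
  then have "x \<le> C * 0"
    by (rule LIMSEQ_le_const) (use le infinity in \<open>auto simp: divide_inverse\<close>)
  then show ?thesis using infinity by (simp add: exp_decay_def)
qed

theorem theorem3:
  fixes \<Delta> :: nat and \<alpha> \<eta> :: real and A :: "real^'q::finite^'q"
  assumes "\<Delta> \<ge> 3" and "CARD('q) \<ge> 2"
    and "0 < \<alpha>" and "\<alpha> < 2 * pi / (3 * real \<Delta>)"
    and "0 < \<eta>" and "\<eta> < 1"
    and "transpose A = A"
    and "\<And>i j. \<bar>A $ i $ j - 1\<bar> < (1 - \<eta>) * (sin (\<alpha> / 2) * cos (\<alpha> * real \<Delta> / 2))"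
  shows "strong_spatial_mixing A (bounded_degree_graphs \<Delta> :: 'v ugraph set) (1 / (1 - \<eta>))"
proof -
  \<comment> \<open>The slack \<open>1 - \<eta>\<close> in the hypothesis is exactly the room to
    scale \<open>A - 1\<close> by complex numbers of modulus up to \<open>r\<close>.\<close>
  define r where "r = 1 / (1 - \<eta>)"
  define b where "b i j = complex_of_real (A $ i $ j - 1)" for i j
  have r: "1 < r" using assms(5,6) by (simp add: r_def)
  have \<alpha>: "real \<Delta> * \<alpha> < 2 * pi / 3" using assms(1,4) by (simp add: field_simps)
  have A: "A $ i $ j = A $ j $ i" for i j
    by (metis assms(7) transpose_def vec_lambda_beta)
  have b_le: "r * cmod (b i j) \<le> sin (\<alpha> / 2) * cos (\<alpha> * real \<Delta> / 2)" for i j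
    unfolding b_def norm_of_real using assms(8)[of i j] assms(6) by (simp add: r_def field_simps)
  \<comment> \<open>Sine and cosine are at most 1 in modulus, so the entries differ from 1 by at
    most \<open>1 / r < 1\<close>.\<close>
  have pos: "A $ i $ j > 0" for i j
  proof -
    have "r * cmod (b i j) \<le> sin (\<alpha> / 2) * cos (\<alpha> * real \<Delta> / 2)" by (rule b_le)
    also have "sin (\<alpha> / 2) * cos (\<alpha> * real \<Delta> / 2) \<le> \<bar>sin (\<alpha> / 2)\<bar> * \<bar>cos (\<alpha> * real \<Delta> / 2)\<bar>"
      by (metis abs_ge_self abs_mult)
    also have "\<dots> \<le> 1 * 1" by (intro mult_mono) auto
    finally have "r * \<bar>A $ i $ j - 1\<bar> \<le> 1" unfolding b_def norm_of_real by simp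
    then have "\<bar>A $ i $ j - 1\<bar> \<le> 1 / r" using r by (simp add: field_simps)
    also have "\<dots> < 1" using r by simp
    finally show ?thesis by linarith
  qed
  have bound: "\<bar>\<P>(\<psi> in hom_measure G A. \<psi> v = i \<bar> boundary_event \<Lambda> \<sigma> \<psi>)
          - \<P>(\<psi> in hom_measure G A. \<psi> v = i \<bar> boundary_event \<Lambda> \<tau> \<psi>)\<bar>
        \<le> 4 * exp_decay r (disagreement_dist G v \<Lambda> \<sigma> \<tau>)"
    if G: "G \<in> bounded_degree_graphs \<Delta>" and v: "v \<in> verts G" and \<Lambda>: "\<Lambda> \<subseteq> verts G - {v}"
      and \<sigma>: "\<sigma> \<in> \<Lambda> \<rightarrow>\<^sub>E UNIV" and \<tau>: "\<tau> \<in> \<Lambda> \<rightarrow>\<^sub>E UNIV"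
    for G :: "'v ugraph" and v i \<Lambda> \<sigma> \<tau>
  proof (rule le_exp_decayI[OF r])
    fix n assume n: "enat n \<le> disagreement_dist G v \<Lambda> \<sigma> \<tau>"
    have simple: "simple_graph G" and deg: "\<And>u. u \<in> verts G \<Longrightarrow> card {e \<in> edges G. u \<in> e} \<le> \<Delta>"
      using G by (auto simp: bounded_degree_graphs_def degree_def)
    have V: "finite (verts G)" and E: "\<And>e. e \<in> edges G \<Longrightarrow> e \<subseteq> verts G \<and> card e = 2"
      using simple by (auto simp: simple_graph_def)
    have fin: "finite (edges G)"
      by (rule finite_subset[of _ "Pow (verts G)"]) (use V E in auto)
    \<comment> \<open>A walk of length \<open>m < n\<close> to a disagreement would push the
      disagreement distance below \<open>n\<close>.\<close>
    have far: "(v, u) \<notin> edge_rel (edges G) ^^ m" if "u \<in> \<Lambda>" "\<sigma> u \<noteq> \<tau> u" "m < n" for u m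
    proof
      assume "(v, u) \<in> edge_rel (edges G) ^^ m"
      then have "(v, u) \<in> adj G ^^ m" by (simp add: adj_def edge_rel_def)
      from adj_relpow_disagreement_dist[of u \<Lambda> \<sigma> \<tau>, OF that(1,2) this] n
      have "enat n \<le> enat m" by (rule order_trans[rotated])
      with that(3) show False by simp
    qed
    have Lv: "\<Lambda> \<subseteq> verts G" "v \<in> verts G - \<Lambda>" using \<Lambda> v by auto
    have b_eq: "(\<lambda>i j. 1 + b i j) = (\<lambda>i j. complex_of_real (A $ i $ j))" by (simp add: b_def fun_eq_iff)
    have b_sym: "b i j = b j i" for i j by (simp add: b_def A[of i j])
    have "cmod (complex_of_real (\<P>(\<psi> in hom_measure G A. \<psi> v = i \<bar> boundary_event \<Lambda> \<sigma> \<psi>))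
        - complex_of_real (\<P>(\<psi> in hom_measure G A. \<psi> v = i \<bar> boundary_event \<Lambda> \<tau> \<psi>))) \<le> 4 / r ^ n"
      unfolding cond_prob_hom_measure[OF simple assms(7) pos \<Lambda> \<sigma>]
        cond_prob_hom_measure[OF simple assms(7) pos \<Lambda> \<tau>] b_eq[symmetric]
      by (rule marginal_difference_decay[OF V fin E deg assms(3) \<alpha> assms(1) less_imp_le[OF r]
            b_sym b_le Lv far])
    then show "\<bar>\<P>(\<psi> in hom_measure G A. \<psi> v = i \<bar> boundary_event \<Lambda> \<sigma> \<psi>)
          - \<P>(\<psi> in hom_measure G A. \<psi> v = i \<bar> boundary_event \<Lambda> \<tau> \<psi>)\<bar> \<le> 4 / r ^ n"
      by (simp only: norm_of_real flip: of_real_diff)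
  qed
  show ?thesis
    unfolding strong_spatial_mixing_def r_def[symmetric]
    using r bound by (intro conjI exI[of _ 4]) auto
qed

end
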